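(* For complex numbers $a\notin\{-1,0,2,\tfrac12\}$ and $f\neq 0$, let $\rho=\rho_{a,f}:B_3\to GL(6,\mathbb{C})$ be the six-dimensional block representation defined in the context. This family separates the following braids, listed with their knots, from their reversed braids; that is, there exist parameters $(a,f)$ such that $\operatorname{Tr}(\rho_{a,f}(w))\neq \operatorname{Tr}(\rho_{a,f}(w'))$ for each braid $w$ in the list, where $w'$ denotes the reverse of $w$: - $6_3$: $w=\sigma_1^{-1}\sigma_2^2\sigma_1^{-2}\sigma_2$; - $7_5$: $w=\sigma_1^{4}\sigma_2\sigma_1^{-1}\sigma_2^2$; - $8_7$: $w=\sigma_1^{4}\sigma_2^{-2}\sigma_1\sigma_2^{-1}$; - $8_9$: $w=\sigma_1^{-1}\sigma_2\sigma_1^{-3}\sigma_2^3$; - $8_{10}$: $w=\sigma_1^{-1}\sigma_2^2\sigma_1^{-2}\sigma_2^3$; - $8_{17}$: $w=\sigma_1^{-1}\sigma_2\sigma_1^{-1}\sigma_2^2\sigma_1^{-2}\sigma_2$; - $9_6$: $w=\sigma_1^2\sigma_2^2\sigma_1^5\sigma_2^{-1}$; - $9_9$: $w=\sigma_1^3\sigma_2^{-1}\sigma_1^4\sigma_2^2$; - $10_5$: $w=\sigma_1^{-2}\sigma_2\sigma_1^{-1}\sigma_2^6$.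
   Context: $B_3=\langle \sigma_1,\sigma_2 \mid \sigma_1\sigma_2\sigma_1=\sigma_2\sigma_1\sigma_2\rangle$ is the braid group on three strings. The reverse of a braid $\sigma_1^{n_1}\sigma_2^{m_1}\cdots\sigma_1^{n_k}\sigma_2^{m_k}$ (with integers $n_j,m_j$) is the braid $\sigma_2^{m_k}\sigma_1^{n_k}\cdots\sigma_2^{m_1}\sigma_1^{n_1}$. A representation separates a braid from its reverse if the traces of their images differ. The knot names only label the braids as the 3-braid words tabulated for those knots. The representation $\rho_{a,f}$: for $a\notin\{-1,0,2,\tfrac12\}$ and $f\neq0$ put $d=1-a-ia\sqrt3$, $g=-1+ia\sqrt3$ (with $i=\sqrt{-1}$), $$A=\begin{pmatrix}a&a-2&a-2\\ -2a+1&d&-2a+1\\ f&f&g\end{pmatrix},\quad B=\begin{pmatrix}a-2&-a+2&-a+2\\ 2a-1&-2a+1&2a-1\\ -f&-f&f\end{pmatrix},\quad D=\begin{pmatrix}-a+3&3a-3&-a-1\\ -a+2&3a-2&-3a\\ 3&2a-1&-2a-1\end{pmatrix}.$$ The matrix $B$ is invertible; let $C=B^{-1}A^2-B^{-1}ABDB^{-1}+D^2B^{-1}$, the unique solution of $A^2B-BCB-ABD+BD^2=0$. Then $$\rho_{a,f}(\sigma_1)=\begin{pmatrix}A&B\\ C&D\end{pmatrix},\qquad \rho_{a,f}(\sigma_2)=\begin{pmatrix}A&-B\\ -C&D\end{pmatrix}$$ defines a representation $B_3\to GL(6,\mathbb{C})$. *)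

theory Defs
  imports "HOL-Analysis.Analysis" "HOL-Algebra.Group"
begin

section \<open>The braid group on three strings\<close>

text \<open>
  The group is given by its presentation: words in the two generators and their formal
  inverses, modulo free cancellation and the braid relation. A letter \<open>(s, True)\<close> stands for the
  generator \<open>s\<close> and \<open>(s, False)\<close> for its inverse.
\<close>

datatype gen = S1 | S2

type_synonym braid_word = "(gen \<times> bool) list"

inductive braid_eq :: "braid_word \<Rightarrow> braid_word \<Rightarrow> bool" where
  refl: "braid_eq u u"
| sym: "braid_eq u v \<Longrightarrow> braid_eq v u"
| trans: "braid_eq u v \<Longrightarrow> braid_eq v w \<Longrightarrow> braid_eq u w"
| app: "braid_eq u v \<Longrightarrow> braid_eq (x @ u @ y) (x @ v @ y)"
| cancel: "braid_eq [(s, b), (s, \<not> b)] []"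
| braid: "braid_eq [(S1, True), (S2, True), (S1, True)] [(S2, True), (S1, True), (S2, True)]"

lemma braid_eq_append:
  assumes "braid_eq u u'" "braid_eq v v'"
  shows "braid_eq (u @ v) (u' @ v')"
  using braid_eq.trans[of "u @ v" "u' @ v" "u' @ v'"]
    braid_eq.app[OF assms(1), of "[]" v] braid_eq.app[OF assms(2), of u' "[]"]
  by simp

lemma braid_eq_rev: "braid_eq u v \<Longrightarrow> braid_eq (rev u) (rev v)"
proof (induction rule: braid_eq.induct)
  case (cancel s b)
  show ?case using braid_eq.cancel[of s "\<not> b"] by simp
next
  case (trans u v w)
  show ?case by (rule braid_eq.trans[OF trans.IH])
next
  case (app u v x y)
  show ?case using braid_eq.app[OF app.IH, of "rev y" "rev x"] by simp
next
  case braid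
  show ?case using braid_eq.braid by simp
qed (simp_all add: braid_eq.refl braid_eq.sym)

definition inv_word :: "braid_word \<Rightarrow> braid_word" where
  "inv_word u = rev (map (\<lambda>(s, b). (s, \<not> b)) u)"

lemma inv_word_append_self: "braid_eq (inv_word u @ u) []"
proof (induction u)
  case Nil
  show ?case by (simp add: inv_word_def braid_eq.refl)
next
  case (Cons l u)
  obtain s b where l: "l = (s, b)" by (cases l)
  have "braid_eq (inv_word u @ [(s, \<not> b), (s, b)] @ u) (inv_word u @ [] @ u)"
    using braid_eq.app[OF braid_eq.cancel[of s "\<not> b"]] by simp
  from braid_eq.trans[OF this] Cons show ?case by (simp add: inv_word_def l)
qed

quotient_type braid3 = braid_word / braid_eq
proof (rule equivpI)
  show "reflp braid_eq" by (simp add: reflp_def braid_eq.refl)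
  show "symp braid_eq" by (simp add: symp_def braid_eq.sym)
  show "transp braid_eq" unfolding transp_def by (blast intro: braid_eq.trans)
qed

lift_definition braid_one :: braid3 is "[]" .

lift_definition braid_mult :: "braid3 \<Rightarrow> braid3 \<Rightarrow> braid3" is "(@)"
  by (rule braid_eq_append)

lift_definition \<sigma> :: "gen \<Rightarrow> braid3" is "\<lambda>s. [(s, True)]" .

definition B3 :: "braid3 monoid" where
  "B3 = \<lparr>carrier = UNIV, monoid.mult = braid_mult, one = braid_one\<rparr>"

lemma B3_simps [simp]:
  "carrier B3 = UNIV" "x \<otimes>\<^bsub>B3\<^esub> y = braid_mult x y" "\<one>\<^bsub>B3\<^esub> = braid_one"
  by (simp_all add: B3_def)

lemma braid_mult_assoc: "braid_mult (braid_mult x y) z = braid_mult x (braid_mult y z)"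
  by transfer (simp add: braid_eq.refl)

lemma braid_mult_one: "braid_mult braid_one x = x" "braid_mult x braid_one = x"
  by (transfer, simp add: braid_eq.refl)+

lemma braid_left_inverse: "\<exists>y. braid_mult y x = braid_one"
  by transfer (blast intro: inv_word_append_self)

lemma group_B3: "group B3"
  by (rule groupI) (auto simp: braid_mult_assoc braid_mult_one braid_left_inverse)

abbreviation \<sigma>1 :: "int \<Rightarrow> braid3" where "\<sigma>1 n \<equiv> \<sigma> S1 [^]\<^bsub>B3\<^esub> n"
abbreviation \<sigma>2 :: "int \<Rightarrow> braid3" where "\<sigma>2 n \<equiv> \<sigma> S2 [^]\<^bsub>B3\<^esub> n"

lemma braid_relation:
  "\<sigma> S1 \<otimes>\<^bsub>B3\<^esub> \<sigma> S2 \<otimes>\<^bsub>B3\<^esub> \<sigma> S1 = \<sigma> S2 \<otimes>\<^bsub>B3\<^esub> \<sigma> S1 \<otimes>\<^bsub>B3\<^esub> \<sigma> S2"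
  by simp (transfer, simp add: braid_eq.braid)

text \<open>
  \<open>braid_of [(n1, m1), \<dots>, (nk, mk)]\<close> is the braid
  \<open>\<sigma>1^n1 \<sigma>2^m1 \<dots> \<sigma>1^nk \<sigma>2^mk\<close>.
\<close>

fun braid_of :: "(int \<times> int) list \<Rightarrow> braid3" where
  "braid_of [] = \<one>\<^bsub>B3\<^esub>"
| "braid_of ((n, m) # ps) = \<sigma>1 n \<otimes>\<^bsub>B3\<^esub> \<sigma>2 m \<otimes>\<^bsub>B3\<^esub> braid_of ps"

text \<open>
  Reading words backwards respects the relations, so the reverse is a well-defined operation on
  braids. Lemma \<open>reverse_braid_of\<close> below gives its value on
  \<open>\<sigma>1^n1 \<sigma>2^m1 \<dots> \<sigma>1^nk \<sigma>2^mk\<close>.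
\<close>

lift_definition reverse :: "braid3 \<Rightarrow> braid3" is rev
  by (rule braid_eq_rev)

lemma reverse_mult: "reverse (x \<otimes>\<^bsub>B3\<^esub> y) = reverse y \<otimes>\<^bsub>B3\<^esub> reverse x"
  by simp (transfer, simp add: braid_eq.refl)

lemma reverse_one [simp]: "reverse braid_one = braid_one"
  by transfer (simp add: braid_eq.refl)

lemma reverse_sigma [simp]: "reverse (\<sigma> s) = \<sigma> s"
  by transfer (simp add: braid_eq.refl)

lemma reverse_inv: "reverse (inv\<^bsub>B3\<^esub> x) = inv\<^bsub>B3\<^esub> (reverse x)"
proof -
  interpret group B3 by (rule group_B3)
  have "reverse x \<otimes>\<^bsub>B3\<^esub> reverse (inv\<^bsub>B3\<^esub> x) = reverse (inv\<^bsub>B3\<^esub> x \<otimes>\<^bsub>B3\<^esub> x)"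
    by (simp only: reverse_mult)
  also have "\<dots> = \<one>\<^bsub>B3\<^esub>"
    using l_inv[of x] by simp
  finally show ?thesis
    using inv_equality[of "reverse (inv\<^bsub>B3\<^esub> x)" "reverse x"] inv_comm by simp
qed

lemma reverse_nat_pow: "reverse (x [^]\<^bsub>B3\<^esub> (n::nat)) = reverse x [^]\<^bsub>B3\<^esub> n"
proof -
  interpret group B3 by (rule group_B3)
  show ?thesis
  proof (induction n)
    case (Suc n)
    then show ?case
      using nat_pow_Suc2[of "reverse x" n] by (simp add: reverse_mult[simplified])
  qed simp
qed

lemma reverse_int_pow: "reverse (x [^]\<^bsub>B3\<^esub> (n::int)) = reverse x [^]\<^bsub>B3\<^esub> n"
  unfolding int_pow_def2 Let_def by (simp only: reverse_inv reverse_nat_pow split: if_split) blast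

lemma reverse_braid_of_Cons:
  "reverse (braid_of ((n, m) # ps)) = reverse (braid_of ps) \<otimes>\<^bsub>B3\<^esub> \<sigma>2 m \<otimes>\<^bsub>B3\<^esub> \<sigma>1 n"
  by (simp add: reverse_mult[simplified] reverse_int_pow braid_mult_assoc)

lemma reverse_braid_of:
  "reverse (braid_of ps) = foldr (\<lambda>(n, m) x. \<sigma>2 m \<otimes>\<^bsub>B3\<^esub> \<sigma>1 n \<otimes>\<^bsub>B3\<^esub> x) (rev ps) \<one>\<^bsub>B3\<^esub>"
proof -
  have *: "foldr (\<lambda>(n, m) x. \<sigma>2 m \<otimes>\<^bsub>B3\<^esub> \<sigma>1 n \<otimes>\<^bsub>B3\<^esub> x) qs y
      = braid_mult (foldr (\<lambda>(n, m) x. \<sigma>2 m \<otimes>\<^bsub>B3\<^esub> \<sigma>1 n \<otimes>\<^bsub>B3\<^esub> x) qs \<one>\<^bsub>B3\<^esub>) y" for qs y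
    by (induction qs) (auto simp: braid_mult_assoc braid_mult_one)
  show ?thesis
  proof (induction ps)
    case (Cons p ps)
    obtain n m where p: "p = (n, m)" by (cases p)
    show ?case
      unfolding p reverse_braid_of_Cons
      using Cons *[of "rev ps" "braid_mult (\<sigma>2 m) (\<sigma>1 n)"]
      by (simp add: braid_mult_assoc braid_mult_one)
  qed simp
qed

section \<open>The representation\<close>

definition GL :: "(complex^'n^'n) monoid" where
  "GL = \<lparr>carrier = {M. invertible M}, monoid.mult = (**), one = mat 1\<rparr>"

text \<open>
  A matrix of size six made of four square blocks of size three is indexed by the type \<open>3 + 3\<close>:
  \<open>Inl\<close> gives the first three rows (columns), \<open>Inr\<close> the last three.
\<close>

definition block_mat ::
  "'a^'n^'n \<Rightarrow> 'a^'m^'n \<Rightarrow> 'a^'n^'m \<Rightarrow> 'a^'m^'m \<Rightarrow> 'a^('n + 'm)^('n + 'm)" where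
  "block_mat A B C D = (\<chi> i j.
     case i of
       Inl k \<Rightarrow> (case j of Inl l \<Rightarrow> A $ k $ l | Inr l \<Rightarrow> B $ k $ l)
     | Inr k \<Rightarrow> (case j of Inl l \<Rightarrow> C $ k $ l | Inr l \<Rightarrow> D $ k $ l))"

definition mat_A :: "complex \<Rightarrow> complex \<Rightarrow> complex^3^3" where
  "mat_A a f =
     (let d = 1 - a - \<i> * a * of_real (sqrt 3); g = - 1 + \<i> * a * of_real (sqrt 3) in
      vector [vector [a, a - 2, a - 2],
              vector [- 2 * a + 1, d, - 2 * a + 1],
              vector [f, f, g]])"

definition mat_B :: "complex \<Rightarrow> complex \<Rightarrow> complex^3^3" where
  "mat_B a f =
     vector [vector [a - 2, - a + 2, - a + 2],
             vector [2 * a - 1, - 2 * a + 1, 2 * a - 1],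
             vector [- f, - f, f]]"

definition mat_D :: "complex \<Rightarrow> complex^3^3" where
  "mat_D a =
     vector [vector [- a + 3, 3 * a - 3, - a - 1],
             vector [- a + 2, 3 * a - 2, - 3 * a],
             vector [3, 2 * a - 1, - 2 * a - 1]]"

definition mat_C :: "complex \<Rightarrow> complex \<Rightarrow> complex^3^3" where
  "mat_C a f =
     (let A = mat_A a f; B = mat_B a f; D = mat_D a; Bi = matrix_inv B in
      Bi ** A ** A - Bi ** A ** B ** D ** Bi + D ** D ** Bi)"

definition rho_sigma1 :: "complex \<Rightarrow> complex \<Rightarrow> complex^(3 + 3)^(3 + 3)" where
  "rho_sigma1 a f = block_mat (mat_A a f) (mat_B a f) (mat_C a f) (mat_D a)"

definition rho_sigma2 :: "complex \<Rightarrow> complex \<Rightarrow> complex^(3 + 3)^(3 + 3)" where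
  "rho_sigma2 a f = block_mat (mat_A a f) (- mat_B a f) (- mat_C a f) (mat_D a)"

text \<open>
  \<open>is_rho a f \<rho>\<close> says that \<open>\<rho>\<close> is the representation with parameters \<open>a\<close> and \<open>f\<close>, that is, a
  homomorphism with the prescribed values on the generators. Lemma \<open>is_rho_unique\<close> shows that
  there is at most one.
\<close>

definition is_rho :: "complex \<Rightarrow> complex \<Rightarrow> (braid3 \<Rightarrow> complex^(3 + 3)^(3 + 3)) \<Rightarrow> bool" where
  "is_rho a f \<rho> \<longleftrightarrow>
     \<rho> \<in> hom B3 GL \<and> \<rho> (\<sigma> S1) = rho_sigma1 a f \<and> \<rho> (\<sigma> S2) = rho_sigma2 a f"

lemma group_GL: "group (GL :: (complex^'n^'n) monoid)"
proof (rule groupI)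
  fix M :: "complex^'n^'n" assume "M \<in> carrier GL"
  then obtain N where "M ** N = mat 1" "N ** M = mat 1"
    by (auto simp: GL_def invertible_def)
  then show "\<exists>y\<in>carrier GL. y \<otimes>\<^bsub>GL\<^esub> M = \<one>\<^bsub>GL\<^esub>"
    by (auto simp: GL_def invertible_def)
next
  show "\<one>\<^bsub>GL\<^esub> \<in> carrier (GL :: (complex^'n^'n) monoid)"
    by (auto simp: GL_def invertible_def intro: exI[of _ "mat 1"])
qed (auto simp: GL_def invertible_mult matrix_mul_assoc)

lemma braid_induct [case_names one gen inv_gen]:
  assumes "P braid_one"
    and "\<And>s x. P x \<Longrightarrow> P (braid_mult (\<sigma> s) x)"
    and "\<And>s x. P x \<Longrightarrow> P (braid_mult (inv\<^bsub>B3\<^esub> (\<sigma> s)) x)"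
  shows "P x"
proof -
  have inv_sigma: "inv\<^bsub>B3\<^esub> (\<sigma> s) = abs_braid3 [(s, False)]" for s
  proof -
    have "braid_mult (abs_braid3 [(s, False)]) (\<sigma> s) = braid_one"
      using braid_eq.cancel[of s False]
      by (simp add: \<sigma>_def braid_mult.abs_eq braid_one_def braid3.abs_eq_iff)
    then show ?thesis
      using group.inv_equality[OF group_B3, of "abs_braid3 [(s, False)]" "\<sigma> s"] by simp
  qed
  have "P (abs_braid3 u)" for u
  proof (induction u)
    case Nil
    show ?case using assms(1) by (simp add: braid_one_def)
  next
    case (Cons l u)
    obtain s b where l: "l = (s, b)" by (cases l)
    have eq: "abs_braid3 (l # u) = braid_mult (abs_braid3 [l]) (abs_braid3 u)"
      by (simp add: braid_mult.abs_eq)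
    show ?case
      using assms(2)[OF Cons, of s] assms(3)[OF Cons, of s]
      by (cases b) (simp_all add: eq inv_sigma, simp_all add: l \<sigma>_def)
  qed
  then show ?thesis by (rule braid3.abs_induct)
qed

lemma is_rho_unique:
  assumes "is_rho a f \<rho>" "is_rho a f \<rho>'"
  shows "\<rho> = \<rho>'"
proof
  interpret h: group_hom B3 GL \<rho>
    using assms(1) by (simp add: group_hom_def group_hom_axioms_def group_B3 group_GL is_rho_def)
  interpret h': group_hom B3 GL \<rho>'
    using assms(2) by (simp add: group_hom_def group_hom_axioms_def group_B3 group_GL is_rho_def)
  have gens: "\<rho> (\<sigma> s) = \<rho>' (\<sigma> s)" for s
    using assms by (cases s) (simp_all add: is_rho_def)
  show "\<rho> x = \<rho>' x" for x
  proof (induction x rule: braid_induct)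
    case one
    show ?case using h.hom_one h'.hom_one by simp
  next
    case (gen s x)
    then show ?case
      using h.hom_mult[of "\<sigma> s" x] h'.hom_mult[of "\<sigma> s" x] gens by simp
  next
    case (inv_gen s x)
    then show ?case
      using h.hom_mult[of "inv\<^bsub>B3\<^esub> (\<sigma> s)" x] h'.hom_mult[of "inv\<^bsub>B3\<^esub> (\<sigma> s)" x]
        h.hom_inv[of "\<sigma> s"] h'.hom_inv[of "\<sigma> s"] gens by simp
  qed
qed

end

theory Submission
  imports Defs
begin

text \<open>
  The parameters \<open>a = 1\<close> and \<open>f = 2\<close> separate all nine braids simultaneously. For them the images of
  the generators have entries in \<open>\<int>[\<surd>-3]\<close>, and so do their inverses after multiplication by 8. A
  braid word and its reverse contain the same number of inverse letters, so the powers of 8 agree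
  and the two traces can be compared by exact arithmetic in \<open>\<int>[\<surd>-3]\<close>.
\<close>

section \<open>Homomorphisms out of the braid group\<close>

definition word_value :: "('a, 'b) monoid_scheme \<Rightarrow> (gen \<Rightarrow> 'a) \<Rightarrow> braid_word \<Rightarrow> 'a" where
  "word_value G g u = foldr (\<lambda>(s, b) z. (if b then g s else inv\<^bsub>G\<^esub> g s) \<otimes>\<^bsub>G\<^esub> z) u \<one>\<^bsub>G\<^esub>"

lemma word_value_simps [simp]:
  "word_value G g [] = \<one>\<^bsub>G\<^esub>"
  "word_value G g ((s, b) # u) = (if b then g s else inv\<^bsub>G\<^esub> g s) \<otimes>\<^bsub>G\<^esub> word_value G g u"
  by (simp_all add: word_value_def)

context group
begin

lemma word_value_closed [simp]:
  assumes "\<And>s. g s \<in> carrier G"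
  shows "word_value G g u \<in> carrier G"
  using assms by (induction u) auto

lemma word_value_append:
  assumes "\<And>s. g s \<in> carrier G"
  shows "word_value G g (u @ v) = word_value G g u \<otimes> word_value G g v"
  using assms by (induction u) (auto simp: m_assoc)

text \<open>Well-definedness on the quotient: each rule generating \<open>braid_eq\<close> preserves
  values in a group, the braid rule by the assumed relation.\<close>

lemma word_value_braid_eq:
  assumes "braid_eq u v"
    and g: "\<And>s. g s \<in> carrier G"
    and "g S1 \<otimes> g S2 \<otimes> g S1 = g S2 \<otimes> g S1 \<otimes> g S2"
  shows "word_value G g u = word_value G g v"
  using assms(1)
proof (induction rule: braid_eq.induct)
  case braid
  show ?case using assms(3) by (simp add: g m_assoc)
qed (auto simp: g word_value_append)

text \<open>Universal property of the presentation. It supplies existence, where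
  \<open>is_rho_unique\<close> supplies uniqueness.\<close>

lemma braid3_hom_exists:
  assumes g: "\<And>s. g s \<in> carrier G"
    and braid: "g S1 \<otimes> g S2 \<otimes> g S1 = g S2 \<otimes> g S1 \<otimes> g S2"
  obtains h where "h \<in> hom B3 G" "\<And>s. h (\<sigma> s) = g s"
proof
  define h where "h x = word_value G g (rep_braid3 x)" for x
  \<comment> \<open>The value does not depend on the representative picked by
    \<open>rep_braid3\<close>.\<close>
  have h_abs: "h (abs_braid3 u) = word_value G g u" for u
    unfolding h_def using Quotient3_rep_abs[OF Quotient3_braid3] braid_eq.refl
    by (blast intro: word_value_braid_eq g braid)
  show "h (\<sigma> s) = g s" for s
    by (simp add: \<sigma>_def h_abs g)
  have "h (braid_mult x y) = h x \<otimes> h y" for x y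
    by (induction x rule: braid3.abs_induct, induction y rule: braid3.abs_induct)
      (simp add: braid_mult.abs_eq h_abs word_value_append g)
  then show "h \<in> hom B3 G"
    by (simp add: hom_def h_def g)
qed

end

section \<open>Matrices over \<open>\<int>[\<surd>-3]\<close>\<close>

text \<open>The pair \<open>(x, y)\<close> encodes \<open>x + y\<surd>-3\<close>.\<close>

definition qev :: "int \<times> int \<Rightarrow> complex" where
  "qev p = of_int (fst p) + of_int (snd p) * (\<i> * of_real (sqrt 3))"

definition qmul :: "int \<times> int \<Rightarrow> int \<times> int \<Rightarrow> int \<times> int" where
  "qmul p q = (fst p * fst q - 3 * (snd p * snd q), fst p * snd q + snd p * fst q)"

lemma root_sq: "(\<i> * complex_of_real (sqrt 3)) * (\<i> * complex_of_real (sqrt 3)) = - 3"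
proof -
  have "complex_of_real (sqrt 3) * complex_of_real (sqrt 3) = 3"
    by (simp flip: of_real_mult)
  then show ?thesis
    by (simp add: algebra_simps)
qed

lemma qev_mul: "qev (qmul p q) = qev p * qev q"
proof -
  have "qev p * qev q = of_int (fst p) * of_int (fst q)
      + of_int (snd p) * of_int (snd q) * ((\<i> * complex_of_real (sqrt 3)) * (\<i> * complex_of_real (sqrt 3)))
      + (of_int (fst p) * of_int (snd q) + of_int (snd p) * of_int (fst q)) * (\<i> * complex_of_real (sqrt 3))"
    by (simp add: qev_def algebra_simps)
  then show ?thesis
    unfolding root_sq by (simp add: qev_def qmul_def algebra_simps)
qed

lemma qev_sum: "qev (sum f A) = (\<Sum>x\<in>A. qev (f x))"
  by (induction A rule: infinite_finite_induct) (simp_all add: qev_def algebra_simps)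

text \<open>The first component is the real part and the second is the imaginary part divided by
  \<open>sqrt 3\<close>. Hence inequality of complex traces can be decided on pairs of
  integers.\<close>

lemma qev_inject: "qev p = qev q \<longleftrightarrow> p = q"
  by (auto simp: qev_def complex_eq_iff prod_eq_iff)

section \<open>Executable 6 by 6 matrices\<close>

type_synonym qmat = "(int \<times> int) list list"

definition sq6 :: "qmat \<Rightarrow> bool" where
  "sq6 L \<longleftrightarrow> length L = 6 \<and> (\<forall>r \<in> set L. length r = 6)"

definition lmul :: "qmat \<Rightarrow> qmat \<Rightarrow> qmat" where
  "lmul L M = map (\<lambda>r. map (\<lambda>j. sum_list (map2 qmul r (map (\<lambda>c. c ! j) M))) [0, 1, 2, 3, 4, 5]) L"

definition lone :: qmat where
  "lone = map (\<lambda>i. map (\<lambda>j. if i = j then (1, 0) else (0, 0)) [0..<6]) [0..<6]"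

definition ltrace :: "qmat \<Rightarrow> int \<times> int" where
  "ltrace L = sum_list (map (\<lambda>i. L ! i ! i) [0, 1, 2, 3, 4, 5])"

text \<open>In the type \<open>3\<close> the numeral \<open>3\<close> equals 0, while
  \<open>vector\<close> fills the positions 1, 2, 3 in this order; so \<open>3\<close> must go to
  the last list position.\<close>

definition ix3 :: "3 \<Rightarrow> nat" where
  "ix3 k = (if k = 1 then 0 else if k = 2 then 1 else 2)"

definition ix :: "3 + 3 \<Rightarrow> nat" where
  "ix i = (case i of Inl k \<Rightarrow> ix3 k | Inr k \<Rightarrow> 3 + ix3 k)"

definition cmat :: "qmat \<Rightarrow> complex^(3 + 3)^(3 + 3)" where
  "cmat L = (\<chi> i j. qev (L ! ix i ! ix j))"

lemma forall_3_plus_3: "(\<forall>i :: 3 + 3. P i) \<longleftrightarrow>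
    P (Inl 1) \<and> P (Inl 2) \<and> P (Inl 3) \<and> P (Inr 1) \<and> P (Inr 2) \<and> P (Inr 3)"
  by (simp add: split_sum_all forall_3)

lemma ix_simps [simp]:
  "ix (Inl 1) = 0" "ix (Inl 2) = 1" "ix (Inl 3) = 2"
  "ix (Inr 1) = 3" "ix (Inr 2) = 4" "ix (Inr 3) = 5"
  by (simp_all add: ix_def ix3_def)

lemma ix_less [simp]: "ix i < 6"
  using forall_3_plus_3[of "\<lambda>i. ix i < 6"] by simp

lemma bij_betw_ix: "bij_betw ix UNIV {..<6}"
proof -
  have inj: "inj ix"
    unfolding inj_def by (simp add: forall_3_plus_3)
  moreover have "ix ` UNIV = {..<6}"
    \<comment> \<open>An injective image of the six indices inside a six-element set fills
      it.\<close>
    using inj by (intro card_subset_eq) (auto simp: card_image)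
  ultimately show ?thesis
    by (simp add: bij_betw_def)
qed

lemma sum_ix: "(\<Sum>i\<in>UNIV. g (ix i)) = sum g {..<6}"
  by (rule sum.reindex_bij_betw[OF bij_betw_ix])

lemma sq6_lmul [simp]: "sq6 L \<Longrightarrow> sq6 (lmul L M)"
  by (auto simp: sq6_def lmul_def)

lemma sq6_lone [simp]: "sq6 lone"
  by (auto simp: sq6_def lone_def)

lemma upt_6: "[0, 1, 2, 3, 4, 5] = [0..<6]"
  by (simp add: upt_rec)

lemma lmul_nth:
  assumes "sq6 L" "sq6 M" "i < 6" "j < 6"
  shows "lmul L M ! i ! j = (\<Sum>k<6. qmul (L ! i ! k) (M ! k ! j))"
proof -
  have "length (L ! i) = 6" "length M = 6" "length L = 6"
    using assms by (auto simp: sq6_def)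
  then show ?thesis
    using assms(3,4) unfolding lmul_def upt_6
    by (simp add: sum_list_sum_nth atLeast0LessThan)
qed

text \<open>With \<open>cmat_lone\<close> this transports identities computed on integer lists to
  complex matrices.\<close>

lemma cmat_lmul:
  assumes "sq6 L" "sq6 M"
  shows "cmat (lmul L M) = cmat L ** cmat M"
  using assms
  by (simp add: cmat_def vec_eq_iff matrix_matrix_mult_def lmul_nth qev_sum qev_mul
      sum_ix[of "\<lambda>k. qev (L ! _ ! k) * qev (M ! k ! _)"])

lemma cmat_lone: "cmat lone = mat 1"
  using bij_betw_ix by (auto simp: cmat_def lone_def mat_def vec_eq_iff qev_def bij_betw_def inj_eq)

lemma trace_cmat: "trace (cmat L) = qev (ltrace L)"
  unfolding ltrace_def upt_6
  by (simp add: trace_def cmat_def qev_sum sum_list_sum_nth atLeast0LessThan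
      sum_ix[of "\<lambda>k. qev (L ! k ! k)"])

section \<open>The representation at \<open>a = 1\<close>, \<open>f = 2\<close>\<close>

text \<open>The tables hold the entries of \<open>rho_sigma1 1 2\<close> and
  \<open>rho_sigma2 1 2\<close>, as \<open>rho_gen_eq\<close> confirms. They differ only in the
  signs of the off-diagonal blocks, that is, by conjugation with \<open>diag(I, -I)\<close>.\<close>

fun lgen :: "gen \<Rightarrow> qmat" where
  "lgen S1 = [
    [(1, 0), (- 1, 0), (- 1, 0), (- 1, 0), (1, 0), (1, 0)],
    [(- 1, 0), (0, - 1), (- 1, 0), (1, 0), (- 1, 0), (1, 0)],
    [(2, 0), (2, 0), (- 1, 1), (- 2, 0), (- 2, 0), (2, 0)],
    [(- 2, 0), (- 1, 1), (2, 0), (2, 0), (0, 0), (- 2, 0)],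
    [(1, 0), (0, 1), (3, 0), (1, 0), (1, 0), (- 3, 0)],
    [(- 1, 0), (- 2, 1), (2, - 1), (3, 0), (1, 0), (- 3, 0)]]"
| "lgen S2 = [
    [(1, 0), (- 1, 0), (- 1, 0), (1, 0), (- 1, 0), (- 1, 0)],
    [(- 1, 0), (0, - 1), (- 1, 0), (- 1, 0), (1, 0), (- 1, 0)],
    [(2, 0), (2, 0), (- 1, 1), (2, 0), (2, 0), (- 2, 0)],
    [(2, 0), (1, - 1), (- 2, 0), (2, 0), (0, 0), (- 2, 0)],
    [(- 1, 0), (0, - 1), (- 3, 0), (1, 0), (1, 0), (- 3, 0)],
    [(1, 0), (2, - 1), (- 2, 1), (3, 0), (1, 0), (- 3, 0)]]"

text \<open>The inverses of the generators have denominator 8, which is cleared here.\<close>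

fun linv :: "gen \<Rightarrow> qmat" where
  "linv S1 = [
    [(2, 0), (2, 0), (2, 0), (- 2, 0), (2, 0), (2, 0)],
    [(- 1, - 1), (1, 1), (- 1, - 1), (- 1, - 1), (1, 1), (- 1, - 1)],
    [(2, - 2), (2, - 2), (0, 0), (2, - 2), (2, - 2), (- 2, 2)],
    [(5, - 1), (7, 1), (1, - 1), (1, - 1), (3, 1), (1, - 1)],
    [(5, - 1), (3, 1), (- 3, - 1), (1, - 1), (3, 1), (- 3, - 1)],
    [(7, - 3), (5, - 1), (1, - 1), (3, - 3), (1, - 1), (- 1, 1)]]"
| "linv S2 = [
    [(2, 0), (2, 0), (2, 0), (2, 0), (- 2, 0), (- 2, 0)],
    [(- 1, - 1), (1, 1), (- 1, - 1), (1, 1), (- 1, - 1), (1, 1)],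
    [(2, - 2), (2, - 2), (0, 0), (- 2, 2), (- 2, 2), (2, - 2)],
    [(- 5, 1), (- 7, - 1), (- 1, 1), (1, - 1), (3, 1), (1, - 1)],
    [(- 5, 1), (- 3, - 1), (3, 1), (1, - 1), (3, 1), (- 3, - 1)],
    [(- 7, 3), (- 5, 1), (- 1, 1), (3, - 3), (1, - 1), (- 1, 1)]]"

lemma sq6_gens [simp]: "sq6 (lgen s)" "sq6 (linv s)"
  by (cases s; simp add: sq6_def)+

definition rho_gen :: "gen \<Rightarrow> complex^(3 + 3)^(3 + 3)" where
  "rho_gen s = (case s of S1 \<Rightarrow> rho_sigma1 1 2 | S2 \<Rightarrow> rho_sigma2 1 2)"

section \<open>The block \<open>C\<close> at the chosen parameters\<close>

lemma vector_3_3_mult: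
  fixes a :: "'a::semiring_1"
  shows "(vector [vector [a, b, c], vector [d, e, f], vector [g, h, i]] :: 'a^3^3) **
      (vector [vector [a', b', c'], vector [d', e', f'], vector [g', h', i']] :: 'a^3^3) =
    (vector [vector [a * a' + b * d' + c * g', a * b' + b * e' + c * h', a * c' + b * f' + c * i'],
      vector [d * a' + e * d' + f * g', d * b' + e * e' + f * h', d * c' + e * f' + f * i'],
      vector [g * a' + h * d' + i * g', g * b' + h * e' + i * h', g * c' + h * f' + i * i']])"
  by (simp add: vec_eq_iff forall_3 matrix_matrix_mult_def sum_3 vector_3)

text \<open>\<open>matrix_inv\<close> is a choice operator: \<open>N\<close> witnesses that the
  chosen matrix is a two-sided inverse, and such inverses are unique.\<close>

lemma matrix_inv_eqI:
  fixes M :: "'a::semiring_1^'n^'n"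
  assumes "M ** N = mat 1" "N ** M = mat 1"
  shows "matrix_inv M = N"
proof -
  have "M ** matrix_inv M = mat 1 \<and> matrix_inv M ** M = mat 1"
    unfolding matrix_inv_def by (rule someI) (use assms in blast)
  then show ?thesis
    by (metis assms(2) matrix_mul_assoc matrix_mul_lid matrix_mul_rid)
qed

lemma matrix_inv_mat_B:
  "matrix_inv (mat_B 1 2) =
     vector [vector [0, 1 / 2, - 1 / 4], vector [1 / 2, 0, - 1 / 4], vector [1 / 2, 1 / 2, 0]]"
  by (rule matrix_inv_eqI)
    (simp_all add: mat_B_def vector_3_3_mult vec_eq_iff forall_3 mat_def)

lemma mat_C_1_2:
  defines "s \<equiv> \<i> * complex_of_real (sqrt 3)"
  shows "mat_C 1 2 =
    vector [vector [- 2, s - 1, 2], vector [1, s, 3], vector [- 1, s - 2, 2 - s]]"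
proof -
  \<comment> \<open>These rules reduce polynomials in \<open>s\<close> to degree at most 1; the
    second one reaches squares inside right-nested products.\<close>
  have s: "s * s = - 3" "s * (s * x) = - 3 * x" for x
    using root_sq by (simp_all add: s_def flip: mult.assoc)
  have A: "mat_A 1 2 = vector [vector [1, - 1, - 1], vector [- 1, - s, - 1], vector [2, 2, s - 1]]"
    by (simp add: mat_A_def s_def Let_def)
  show ?thesis
    unfolding mat_C_def Let_def matrix_inv_mat_B A
    by (simp add: mat_B_def mat_D_def vector_3_3_mult vec_eq_iff forall_3 field_simps s)
qed

lemma rho_gen_eq: "rho_gen s = cmat (lgen s)"
  by (cases s; simp add: rho_gen_def rho_sigma1_def rho_sigma2_def block_mat_def mat_C_1_2 vec_eq_iff
      forall_3_plus_3 cmat_def qev_def mat_A_def mat_B_def mat_D_def Let_def)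

section \<open>Inverses and the braid relation by exact computation\<close>

declare lgen.simps [simp del] linv.simps [simp del]

lemma lgen_linv: "lmul (lgen s) (linv s) = map (map (\<lambda>(x, y). (8 * x, 8 * y))) lone"
proof (cases s)
  case S1
  show ?thesis unfolding S1 by code_simp
next
  case S2
  show ?thesis unfolding S2 by code_simp
qed

lemma lgen_braid:
  "lmul (lmul (lgen S1) (lgen S2)) (lgen S1) = lmul (lmul (lgen S2) (lgen S1)) (lgen S2)"
  by code_simp

lemma cmat_scale:
  assumes "sq6 L"
  shows "cmat (map (map (\<lambda>(x, y). (8 * x, 8 * y))) L) = 8 *\<^sub>R cmat L"
proof -
  have "length (L ! ix i) = 6" "length L = 6" for i
    using assms by (auto simp: sq6_def)
  then show ?thesis
    by (simp add: cmat_def vec_eq_iff qev_def case_prod_unfold scaleR_conv_of_real algebra_simps)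
qed

lemma rho_gen_inverse:
  "rho_gen s ** ((1 / 8) *\<^sub>R cmat (linv s)) = mat 1"
  "((1 / 8) *\<^sub>R cmat (linv s)) ** rho_gen s = mat 1"
proof -
  have "rho_gen s ** cmat (linv s) = 8 *\<^sub>R mat 1"
    by (simp add: rho_gen_eq lgen_linv cmat_scale cmat_lone flip: cmat_lmul)
  then show "rho_gen s ** ((1 / 8) *\<^sub>R cmat (linv s)) = mat 1"
    by (simp add: matrix_scalar_ac flip: scalar_matrix_assoc)
  \<comment> \<open>A right inverse of a square complex matrix is a left inverse, so computing one
    product suffices.\<close>
  then show "((1 / 8) *\<^sub>R cmat (linv s)) ** rho_gen s = mat 1"
    by (simp only: matrix_left_right_inverse)
qed

lemma GL_simps [simp]:
  "carrier GL = {M :: complex^'n^'n. invertible M}"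
  "x \<otimes>\<^bsub>GL\<^esub> y = x ** y" "\<one>\<^bsub>GL\<^esub> = mat 1"
  by (simp_all add: GL_def)

lemma rho_gen_carrier: "rho_gen s \<in> carrier GL"
  using rho_gen_inverse by (auto simp: invertible_def)

lemma inv_rho_gen: "inv\<^bsub>GL\<^esub> rho_gen s = (1 / 8) *\<^sub>R cmat (linv s)"
proof (rule group.inv_equality[OF group_GL])
  show "(1 / 8) *\<^sub>R cmat (linv s) \<in> carrier GL"
    using rho_gen_inverse by (auto simp: invertible_def)
qed (use rho_gen_carrier rho_gen_inverse in simp_all)

text \<open>The braid relation for the complex matrices is the image under \<open>cmat\<close> of
  the computed identity \<open>lgen_braid\<close>.\<close>

lemma rho_exists: obtains \<rho> where "is_rho 1 2 \<rho>"
proof -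
  have "rho_gen S1 ** rho_gen S2 ** rho_gen S1 = rho_gen S2 ** rho_gen S1 ** rho_gen S2"
    using arg_cong[OF lgen_braid, of cmat] by (simp add: rho_gen_eq cmat_lmul)
  then obtain \<rho> where "\<rho> \<in> hom B3 GL" "\<And>s. \<rho> (\<sigma> s) = rho_gen s"
    using group.braid3_hom_exists[OF group_GL, of rho_gen] rho_gen_carrier by auto
  then have "is_rho 1 2 \<rho>"
    by (simp add: is_rho_def rho_gen_def)
  then show ?thesis ..
qed

section \<open>Traces\<close>

text \<open>\<open>8 ^ k\<close> is a common denominator of the entries of \<open>M\<close>, not
  necessarily the least one; \<open>k\<close> will count inverse letters.\<close>

definition scaled :: "complex^(3 + 3)^(3 + 3) \<Rightarrow> nat \<Rightarrow> qmat \<Rightarrow> bool" where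
  "scaled M k L \<longleftrightarrow> sq6 L \<and> 8 ^ k *\<^sub>R M = cmat L"

lemma scaled_one: "scaled (mat 1) 0 lone"
  by (simp add: scaled_def cmat_lone)

lemma scaled_mult:
  assumes "scaled M k L" "scaled N l K"
  shows "scaled (M ** N) (k + l) (lmul L K)"
proof -
  have "8 ^ (k + l) *\<^sub>R (M ** N) = (8 ^ k *\<^sub>R M) ** (8 ^ l *\<^sub>R N)"
    by (simp add: power_add matrix_scalar_ac mult.commute flip: scalar_matrix_assoc)
  with assms show ?thesis
    by (simp add: scaled_def cmat_lmul)
qed

lemma trace_scaled: "scaled M k L \<Longrightarrow> 8 ^ k * trace M = qev (ltrace L)"
  unfolding scaled_def trace_cmat[symmetric]
  by (metis (no_types, lifting) trace_def sum_distrib_left sum.cong vector_scaleR_component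
      scaleR_conv_of_real of_real_power of_real_numeral)

fun lpow :: "qmat \<Rightarrow> nat \<Rightarrow> qmat" where
  "lpow L 0 = lone"
| "lpow L (Suc n) = lmul (lpow L n) L"

lemma scaled_nat_pow:
  assumes "scaled M k L"
  shows "scaled (M [^]\<^bsub>GL\<^esub> n) (k * n) (lpow L n)"
  using assms by (induction n) (auto simp: scaled_one add.commute dest: scaled_mult)

definition lgen_pow :: "gen \<Rightarrow> int \<Rightarrow> qmat" where
  "lgen_pow s n = (if n < 0 then lpow (linv s) (nat (- n)) else lpow (lgen s) (nat n))"

text \<open>Since \<open>nat (- n)\<close> is 0 for nonnegative \<open>n\<close>, one exponent
  covers both signs: only inverse letters contribute a factor 8.\<close>

lemma scaled_int_pow: "scaled (rho_gen s [^]\<^bsub>GL\<^esub> n) (nat (- n)) (lgen_pow s n)"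
proof -
  have "scaled (rho_gen s) 0 (lgen s)"
    by (simp add: scaled_def rho_gen_eq)
  moreover have "scaled (inv\<^bsub>GL\<^esub> rho_gen s) 1 (linv s)"
    by (simp add: scaled_def inv_rho_gen)
  ultimately have pow: "scaled (rho_gen s [^]\<^bsub>GL\<^esub> k) 0 (lpow (lgen s) k)"
    "scaled ((inv\<^bsub>GL\<^esub> rho_gen s) [^]\<^bsub>GL\<^esub> k) k (lpow (linv s) k)" for k :: nat
    by (auto dest: scaled_nat_pow)
  show ?thesis
  proof (cases "n < 0")
    case True
    then have "rho_gen s [^]\<^bsub>GL\<^esub> n = (inv\<^bsub>GL\<^esub> rho_gen s) [^]\<^bsub>GL\<^esub> nat (- n)"
      by (simp only: int_pow_def2 Let_def if_True group.nat_pow_inv[OF group_GL rho_gen_carrier])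
    then show ?thesis
      using pow(2) True by (simp only: lgen_pow_def if_True)
  next
    case False
    then have "rho_gen s [^]\<^bsub>GL\<^esub> n = rho_gen s [^]\<^bsub>GL\<^esub> nat n" "nat (- n) = 0"
      by (simp_all only: int_pow_def2 Let_def if_False nat_eq_iff) simp
    then show ?thesis
      using pow(1) False by (simp only: lgen_pow_def if_False)
  qed
qed

fun lbraid :: "(int \<times> int) list \<Rightarrow> qmat" where
  "lbraid [] = lone"
| "lbraid ((n, m) # ps) = lmul (lmul (lgen_pow S1 n) (lgen_pow S2 m)) (lbraid ps)"

fun lreverse :: "(int \<times> int) list \<Rightarrow> qmat" where
  "lreverse [] = lone"
| "lreverse ((n, m) # ps) = lmul (lmul (lreverse ps) (lgen_pow S2 m)) (lgen_pow S1 n)"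

definition neg_length :: "(int \<times> int) list \<Rightarrow> nat" where
  "neg_length ps = (\<Sum>(n, m)\<leftarrow>ps. nat (- n) + nat (- m))"

context
  fixes \<rho>
  assumes rho: "is_rho 1 2 \<rho>"
begin

interpretation group_hom B3 GL \<rho>
  using rho by (simp add: group_hom_def group_hom_axioms_def group_B3 group_GL is_rho_def)

lemma rho_mult: "\<rho> (braid_mult x y) = \<rho> x ** \<rho> y"
  using hom_mult[of x y] by simp

lemma rho_one: "\<rho> braid_one = mat 1"
  using hom_one by simp

lemma rho_pow: "scaled (\<rho> (\<sigma> s [^]\<^bsub>B3\<^esub> n)) (nat (- n)) (lgen_pow s n)" for n :: int
proof -
  have "\<rho> (\<sigma> s) = rho_gen s"
    using rho by (cases s) (simp_all add: is_rho_def rho_gen_def)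
  then show ?thesis
    using hom_int_pow[of "\<sigma> s" n] scaled_int_pow by simp
qed

lemma scaled_braid_of: "scaled (\<rho> (braid_of ps)) (neg_length ps) (lbraid ps)"
proof (induction ps rule: lbraid.induct)
  case (2 n m ps)
  show ?case
    using scaled_mult[OF scaled_mult[OF rho_pow rho_pow] 2, of S1 n S2 m]
    by (simp add: rho_mult neg_length_def)
qed (simp add: rho_one neg_length_def scaled_one)

text \<open>Reversal permutes the syllables and keeps their exponents, so the power of 8 is the same
  as in \<open>scaled_braid_of\<close>.\<close>

lemma scaled_reverse: "scaled (\<rho> (reverse (braid_of ps))) (neg_length ps) (lreverse ps)"
proof (induction ps rule: lbraid.induct)
  case (2 n m ps)
  show ?case
    unfolding reverse_braid_of_Cons
    using scaled_mult[OF scaled_mult[OF 2 rho_pow] rho_pow, of S2 m S1 n]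
    by (simp add: rho_mult neg_length_def ac_simps)
qed (simp add: rho_one neg_length_def scaled_one)

text \<open>Both traces are multiplied by the same power of 8, so equal traces would give equal
  values of \<open>qev\<close>, hence equal pairs by \<open>qev_inject\<close>.\<close>

lemma trace_reverse_neq:
  assumes "ltrace (lbraid ps) \<noteq> ltrace (lreverse ps)"
  shows "trace (\<rho> (braid_of ps)) \<noteq> trace (\<rho> (reverse (braid_of ps)))"
  using assms trace_scaled[OF scaled_braid_of] trace_scaled[OF scaled_reverse]
  by (metis qev_inject)

end

section \<open>Exact trace comparison for the nine words\<close>

lemma ltrace_neq_6_3:
  "ltrace (lbraid [(- 1, 2), (- 2, 1)]) \<noteq> ltrace (lreverse [(- 1, 2), (- 2, 1)])"
  by code_simp

lemma ltrace_neq_7_5: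
  "ltrace (lbraid [(4, 1), (- 1, 2)]) \<noteq> ltrace (lreverse [(4, 1), (- 1, 2)])"
  by code_simp

lemma ltrace_neq_8_7:
  "ltrace (lbraid [(4, - 2), (1, - 1)]) \<noteq> ltrace (lreverse [(4, - 2), (1, - 1)])"
  by code_simp

lemma ltrace_neq_8_9:
  "ltrace (lbraid [(- 1, 1), (- 3, 3)]) \<noteq> ltrace (lreverse [(- 1, 1), (- 3, 3)])"
  by code_simp

lemma ltrace_neq_8_10:
  "ltrace (lbraid [(- 1, 2), (- 2, 3)]) \<noteq> ltrace (lreverse [(- 1, 2), (- 2, 3)])"
  by code_simp

lemma ltrace_neq_8_17:
  "ltrace (lbraid [(- 1, 1), (- 1, 2), (- 2, 1)]) \<noteq> ltrace (lreverse [(- 1, 1), (- 1, 2), (- 2, 1)])"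
  by code_simp

lemma ltrace_neq_9_6:
  "ltrace (lbraid [(2, 2), (5, - 1)]) \<noteq> ltrace (lreverse [(2, 2), (5, - 1)])"
  by code_simp

lemma ltrace_neq_9_9:
  "ltrace (lbraid [(3, - 1), (4, 2)]) \<noteq> ltrace (lreverse [(3, - 1), (4, 2)])"
  by code_simp

lemma ltrace_neq_10_5:
  "ltrace (lbraid [(- 2, 1), (- 1, 6)]) \<noteq> ltrace (lreverse [(- 2, 1), (- 1, 6)])"
  by code_simp

theorem theorem5p3:
  shows "\<exists>a f :: complex. a \<notin> {- 1, 0, 2, 1 / 2} \<and> f \<noteq> 0 \<and>
    (\<exists>\<rho>. is_rho a f \<rho> \<and>
      (\<forall>w \<in> {
         \<comment> \<open>6_3\<close> braid_of [(- 1, 2), (- 2, 1)],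
         \<comment> \<open>7_5\<close> braid_of [(4, 1), (- 1, 2)],
         \<comment> \<open>8_7\<close> braid_of [(4, - 2), (1, - 1)],
         \<comment> \<open>8_9\<close> braid_of [(- 1, 1), (- 3, 3)],
         \<comment> \<open>8_10\<close> braid_of [(- 1, 2), (- 2, 3)],
         \<comment> \<open>8_17\<close> braid_of [(- 1, 1), (- 1, 2), (- 2, 1)],
         \<comment> \<open>9_6\<close> braid_of [(2, 2), (5, - 1)],
         \<comment> \<open>9_9\<close> braid_of [(3, - 1), (4, 2)],
         \<comment> \<open>10_5\<close> braid_of [(- 2, 1), (- 1, 6)]}.
        trace (\<rho> w) \<noteq> trace (\<rho> (reverse w))))"
proof -
  obtain \<rho> where rho: "is_rho 1 2 \<rho>"
    by (rule rho_exists)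
  show ?thesis
  proof (intro exI conjI)
    \<comment> \<open>This fixes the witnesses \<open>a = 1\<close> and \<open>f = 2\<close>; the
      conditions on them then become numeral facts, left to the final
      \<open>simp_all\<close>.\<close>
    show "is_rho 1 2 \<rho>"
      by (rule rho)
    show "\<forall>w \<in> {
        braid_of [(- 1, 2), (- 2, 1)], braid_of [(4, 1), (- 1, 2)], braid_of [(4, - 2), (1, - 1)],
        braid_of [(- 1, 1), (- 3, 3)], braid_of [(- 1, 2), (- 2, 3)],
        braid_of [(- 1, 1), (- 1, 2), (- 2, 1)], braid_of [(2, 2), (5, - 1)],
        braid_of [(3, - 1), (4, 2)], braid_of [(- 2, 1), (- 1, 6)]}.
        trace (\<rho> w) \<noteq> trace (\<rho> (reverse w))"
      unfolding ball_simps
      by (intro conjI TrueI trace_reverse_neq[OF rho]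
          ltrace_neq_6_3 ltrace_neq_7_5 ltrace_neq_8_7 ltrace_neq_8_9 ltrace_neq_8_10
          ltrace_neq_8_17 ltrace_neq_9_6 ltrace_neq_9_9 ltrace_neq_10_5)
  qed simp_all
qed

end
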